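(* Let $(\mathcal{C},\cdot,n)$ be a Cayley algebra over a field $\mathbb{F}$ and $(\mathcal{C},\bullet,n)$ the associated para-Cayley algebra ($x\bullet y=\bar x\cdot\bar y$ for any $x,y\in\mathcal{C}$). Then $$\{\text{idempotents of }(\mathcal{C},\bullet,n)\}=\{1\}\cup\{w\in\mathcal{C}\setminus\mathbb{F}1: w^2+w+1=0\}$$ (where $w^2=w\cdot w$), and all the idempotents, with the exception of the para-unit $1$, are conjugate under $\mathrm{Aut}(\mathcal{C},\cdot,n)=\mathrm{Aut}(\mathcal{C},\bullet,n)$. In particular: - If either $\mathrm{char}\,\mathbb{F}\neq 3$ and $(\mathcal{C},\cdot,n)$ contains a subalgebra isomorphic to the quadratic étale algebra $\mathcal{K}=\mathbb{F}[X]/(X^2+X+1)$, or $\mathrm{char}\,\mathbb{F}=3$ and $(\mathcal{C},\cdot,n)$ is split, then $(\mathcal{C},\bullet,n)$ contains the para-unit and a unique conjugacy class of other idempotents. - Otherwise, the only idempotent of $(\mathcal{C},\bullet,n)$ is its para-unit.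
   Context: Idempotents are always nonzero. A Cayley algebra over $\mathbb{F}$ is an $8$-dimensional unital, not necessarily associative algebra $(\mathcal{C},\cdot)$ with a nonsingular quadratic form $n$ satisfying $n(x\cdot y)=n(x)n(y)$; polar form $n(x,y)=n(x+y)-n(x)-n(y)$, conjugation $\bar x=n(x,1)1-x$. It is split if its norm is isotropic. A para-unit of $(\mathcal{C},\bullet,n)$ is an idempotent $e$ with $e\bullet x=x\bullet e=n(e,x)e-x$ for all $x$; the unity $1$ of $(\mathcal{C},\cdot,n)$ is the unique para-unit of the para-Cayley algebra. *)

theory Defs
  imports Complex_Main "HOL-Computational_Algebra.Polynomial"
begin

definition polar :: "('c::ab_group_add \<Rightarrow> 'f::field) \<Rightarrow> 'c \<Rightarrow> 'c \<Rightarrow> 'f" where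
  "polar n x y = n (x + y) - n x - n y"

definition quadratic_form ::
  "('f::field \<Rightarrow> 'c::ab_group_add \<Rightarrow> 'c) \<Rightarrow> ('c \<Rightarrow> 'f) \<Rightarrow> bool" where
  "quadratic_form scale n \<longleftrightarrow>
     (\<forall>a x. n (scale a x) = a\<^sup>2 * n x) \<and>
     (\<forall>x. Vector_Spaces.linear scale (*) (\<lambda>y. polar n x y)) \<and>
     (\<forall>y. Vector_Spaces.linear scale (*) (\<lambda>x. polar n x y))"

text \<open>
  In even dimension a quadratic form is nonsingular, in any characteristic, precisely when its
  polar form is nondegenerate.
\<close>

definition nonsingular_form :: "('c::ab_group_add \<Rightarrow> 'f::field) \<Rightarrow> bool" where
  "nonsingular_form n \<longleftrightarrow> (\<forall>x. (\<forall>y. polar n x y = 0) \<longrightarrow> x = 0)"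

definition isotropic_form :: "('c::ab_group_add \<Rightarrow> 'f::field) \<Rightarrow> bool" where
  "isotropic_form n \<longleftrightarrow> (\<exists>x. x \<noteq> 0 \<and> n x = 0)"

text \<open>
  The vector space is the whole type \<open>'c\<close>; \<open>dim\<close> is \<open>0\<close> for spaces of infinite dimension,
  so \<open>dim UNIV = 8\<close> includes finite dimensionality.
\<close>

locale cayley_algebra = vector_space scale
  for scale :: "'f::field \<Rightarrow> 'c::ab_group_add \<Rightarrow> 'c" +
  fixes cmult :: "'c \<Rightarrow> 'c \<Rightarrow> 'c"
    and one :: 'c
    and n :: "'c \<Rightarrow> 'f"
  assumes dim_eq_8: "dim UNIV = 8"
    and mult_linear_right: "Vector_Spaces.linear scale scale (\<lambda>y. cmult x y)"
    and mult_linear_left: "Vector_Spaces.linear scale scale (\<lambda>x. cmult x y)"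
    and one_mult: "cmult one x = x"
    and mult_one: "cmult x one = x"
    and quadratic: "quadratic_form scale n"
    and nonsingular: "nonsingular_form n"
    and norm_mult: "n (cmult x y) = n x * n y"

definition conjugation ::
  "('f::field \<Rightarrow> 'c::ab_group_add \<Rightarrow> 'c) \<Rightarrow> 'c \<Rightarrow> ('c \<Rightarrow> 'f) \<Rightarrow> 'c \<Rightarrow> 'c" where
  "conjugation scale one n x = scale (polar n x one) one - x"

definition para_mult ::
  "('f::field \<Rightarrow> 'c::ab_group_add \<Rightarrow> 'c) \<Rightarrow> ('c \<Rightarrow> 'c \<Rightarrow> 'c) \<Rightarrow> 'c \<Rightarrow> ('c \<Rightarrow> 'f)
     \<Rightarrow> 'c \<Rightarrow> 'c \<Rightarrow> 'c" where
  "para_mult scale cmult one n x y =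
     cmult (conjugation scale one n x) (conjugation scale one n y)"

definition idempotents :: "('c::ab_group_add \<Rightarrow> 'c \<Rightarrow> 'c) \<Rightarrow> 'c set" where
  "idempotents m = {e. e \<noteq> 0 \<and> m e e = e}"

definition para_units ::
  "('f::field \<Rightarrow> 'c::ab_group_add \<Rightarrow> 'c) \<Rightarrow> ('c \<Rightarrow> 'c \<Rightarrow> 'c) \<Rightarrow> ('c \<Rightarrow> 'f) \<Rightarrow> 'c set" where
  "para_units scale m n =
     {e \<in> idempotents m.
        \<forall>x. m e x = scale (polar n e x) e - x \<and> m x e = scale (polar n e x) e - x}"

definition Aut ::
  "('f::field \<Rightarrow> 'c::ab_group_add \<Rightarrow> 'c) \<Rightarrow> ('c \<Rightarrow> 'c \<Rightarrow> 'c) \<Rightarrow> ('c \<Rightarrow> 'f) \<Rightarrow> ('c \<Rightarrow> 'c) set" where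
  "Aut scale m n =
     {\<phi>. Vector_Spaces.linear scale scale \<phi> \<and> bij \<phi> \<and>
         (\<forall>x y. \<phi> (m x y) = m (\<phi> x) (\<phi> y)) \<and> (\<forall>x. n (\<phi> x) = n x)}"

definition conj_class :: "('c \<Rightarrow> 'c) set \<Rightarrow> 'c \<Rightarrow> 'c set" where
  "conj_class G x = {\<phi> x |\<phi>. \<phi> \<in> G}"

definition subalgebra ::
  "('f::field \<Rightarrow> 'c::ab_group_add \<Rightarrow> 'c) \<Rightarrow> ('c \<Rightarrow> 'c \<Rightarrow> 'c) \<Rightarrow> 'c set \<Rightarrow> bool" where
  "subalgebra scale m S \<longleftrightarrow> module.subspace scale S \<and> (\<forall>x\<in>S. \<forall>y\<in>S. m x y \<in> S)"

text \<open>The algebra \<open>F[X]/(X\<^sup>2 + X + 1)\<close>.\<close>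

quotient_type (overloaded) 'f omega_alg =
  "'f::field poly" / "\<lambda>p q. [:1, 1, 1:] dvd (p - q)"
proof (rule equivpI)
  show "reflp (\<lambda>p q :: 'f poly. [:1, 1, 1:] dvd (p - q))"
    by (auto intro: reflpI)
  show "symp (\<lambda>p q :: 'f poly. [:1, 1, 1:] dvd (p - q))"
    by (auto intro: sympI simp: dvd_diff_commute)
  show "transp (\<lambda>p q :: 'f poly. [:1, 1, 1:] dvd (p - q))"
  proof (rule transpI)
    fix p q r :: "'f poly"
    assume "[:1, 1, 1:] dvd (p - q)" "[:1, 1, 1:] dvd (q - r)"
    then have "[:1, 1, 1:] dvd (p - q) + (q - r)" by (rule dvd_add)
    then show "[:1, 1, 1:] dvd (p - r)" by simp
  qed
qed

instantiation omega_alg :: (field) comm_ring_1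
begin

lift_definition zero_omega_alg :: "'a omega_alg" is 0 .

lift_definition one_omega_alg :: "'a omega_alg" is 1 .

lift_definition plus_omega_alg :: "'a omega_alg \<Rightarrow> 'a omega_alg \<Rightarrow> 'a omega_alg" is "(+)"
  by (metis add_diff_add dvd_add)

lift_definition minus_omega_alg :: "'a omega_alg \<Rightarrow> 'a omega_alg \<Rightarrow> 'a omega_alg" is "(-)"
proof -
  fix p q r s :: "'a poly"
  assume "[:1, 1, 1:] dvd (p - q)" "[:1, 1, 1:] dvd (r - s)"
  then have "[:1, 1, 1:] dvd (p - q) - (r - s)" by (rule dvd_diff)
  then show "[:1, 1, 1:] dvd (p - r - (q - s))" by (simp add: algebra_simps)
qed

lift_definition uminus_omega_alg :: "'a omega_alg \<Rightarrow> 'a omega_alg" is uminus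
  by (metis dvd_minus_iff minus_diff_minus)

lift_definition times_omega_alg :: "'a omega_alg \<Rightarrow> 'a omega_alg \<Rightarrow> 'a omega_alg" is "(*)"
proof -
  fix p q r s :: "'a poly"
  assume "[:1, 1, 1:] dvd (p - q)" "[:1, 1, 1:] dvd (r - s)"
  then have "[:1, 1, 1:] dvd (p - q) * r + q * (r - s)" by (intro dvd_add dvd_mult dvd_mult2)
  then show "[:1, 1, 1:] dvd (p * r - q * s)" by (simp add: algebra_simps)
qed

instance
proof
  show "(0 :: 'a omega_alg) \<noteq> 1"
  proof (transfer, rule notI)
    assume "[:1, 1, 1:] dvd (0 - 1 :: 'a poly)"
    then have "degree [:1, 1, 1 :: 'a:] \<le> degree (0 - 1 :: 'a poly)"
      by (rule dvd_imp_degree_le) simp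
    then show False by simp
  qed
qed (transfer, simp add: algebra_simps)+

end

lift_definition scale_omega :: "'f::field \<Rightarrow> 'f omega_alg \<Rightarrow> 'f omega_alg" is smult
  by (metis dvd_smult smult_diff_right)

definition contains_copy_of_omega_alg ::
  "('f::field \<Rightarrow> 'c::ab_group_add \<Rightarrow> 'c) \<Rightarrow> ('c \<Rightarrow> 'c \<Rightarrow> 'c) \<Rightarrow> bool" where
  "contains_copy_of_omega_alg scale m \<longleftrightarrow>
     (\<exists>S. subalgebra scale m S \<and>
        (\<exists>\<phi>. Vector_Spaces.linear scale_omega scale \<phi> \<and> bij_betw \<phi> UNIV S \<and>
             (\<forall>x y. \<phi> (x * y) = m (\<phi> x) (\<phi> y))))"

lemma vector_space_scale_omega: "vector_space (scale_omega :: 'f::field \<Rightarrow> _)"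
  by unfold_locales (transfer, simp add: smult_add_left smult_add_right)+

end

theory Submission
  imports Defs "HOL-Library.Product_Plus"
begin

text \<open>
  An element \<open>w\<close> outside \<open>F1\<close> with \<open>w\<^sup>2 + w + 1 = 0\<close> has \<open>n(w) = 1\<close> and \<open>n(w,1) = -1\<close>. Choose \<open>p\<close> orthogonal
  to \<open>1\<close> such that \<open>1, w, p, wp\<close> span a nondegenerate (quaternion) subalgebra, and \<open>u\<close> orthogonal to
  that subalgebra with \<open>n(u) \<noteq> 0\<close>. By Cayley--Dickson doubling the multiplication table in the
  resulting basis depends only on \<open>\<sigma> = n(w,p)\<close>, \<open>\<nu> = n(p)\<close> and \<open>\<mu> = n(u)\<close>, so two elements \<open>w\<close>, \<open>w'\<close> are
  conjugate as soon as triples with equal invariants exist. If the norm is anisotropic, then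
  \<open>p \<in> {1, w, w'}\<^sup>\<bottom>\<close> and \<open>u \<in> {1, w, w', p, wp, w'p}\<^sup>\<bottom>\<close> can be chosen in common, because these sets
  have fewer than eight elements; no Witt cancellation is needed. If the norm is isotropic, then in
  every characteristic one can reach \<open>(\<sigma>, \<nu>, \<mu>) = (1, 0, 1)\<close>.
\<close>

subsection \<open>Composition identities\<close>

context cayley_algebra
begin

notation scale (infixr "*s" 75)
notation cmult (infixl "\<cdot>" 70)

abbreviation pol :: "'c \<Rightarrow> 'c \<Rightarrow> 'f" where
  "pol \<equiv> polar n"

abbreviation bar :: "'c \<Rightarrow> 'c" where
  "bar \<equiv> conjugation scale one n"

lemma mult_add_right: "x \<cdot> (y + z) = x \<cdot> y + x \<cdot> z"
  and mult_scale_right: "x \<cdot> (a *s y) = a *s (x \<cdot> y)"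
  using mult_linear_right[of x] by (simp_all add: linear_iff_module_hom module_hom_iff)

lemma mult_add_left: "(x + y) \<cdot> z = x \<cdot> z + y \<cdot> z"
  and mult_scale_left: "(a *s x) \<cdot> z = a *s (x \<cdot> z)"
  using mult_linear_left[of z] by (simp_all add: linear_iff_module_hom module_hom_iff)

lemma mult_minus_right: "x \<cdot> (- y) = - (x \<cdot> y)"
  using mult_scale_right[of x "-1" y] by simp

lemma mult_minus_left: "(- x) \<cdot> y = - (x \<cdot> y)"
  using mult_scale_left[of "-1" x y] by simp

lemma mult_diff_right: "x \<cdot> (y - z) = x \<cdot> y - x \<cdot> z"
  using mult_add_right[of x y "- z"] by (simp add: mult_minus_right)

lemma mult_diff_left: "(x - y) \<cdot> z = x \<cdot> z - y \<cdot> z"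
  using mult_add_left[of x "- y" z] by (simp add: mult_minus_left)

lemma mult_zero_right: "x \<cdot> 0 = 0"
  using mult_diff_right[of x 0 0] by simp

lemma mult_zero_left: "0 \<cdot> x = 0"
  using mult_diff_left[of 0 0 x] by simp

lemmas mult_bilinear =
  mult_add_right mult_add_left mult_scale_right mult_scale_left mult_minus_right mult_minus_left
  mult_diff_right mult_diff_left mult_zero_right mult_zero_left one_mult mult_one

lemma norm_scale: "n (a *s x) = a\<^sup>2 * n x"
  using quadratic by (simp add: quadratic_form_def)

lemma pol_add_right: "pol x (y + z) = pol x y + pol x z"
  and pol_scale_right: "pol x (a *s y) = a * pol x y"
  and pol_add_left: "pol (x + y) z = pol x z + pol y z"
  and pol_scale_left: "pol (a *s x) y = a * pol x y"
  using quadratic by (simp_all add: quadratic_form_def linear_iff_module_hom module_hom_iff)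

lemma pol_minus_right: "pol x (- y) = - pol x y"
  using pol_scale_right[of x "-1" y] by simp

lemma pol_minus_left: "pol (- x) y = - pol x y"
  using pol_scale_left[of "-1" x y] by simp

lemma pol_diff_right: "pol x (y - z) = pol x y - pol x z"
  using pol_add_right[of x y "- z"] by (simp add: pol_minus_right)

lemma pol_diff_left: "pol (x - y) z = pol x z - pol y z"
  using pol_add_left[of x "- y" z] by (simp add: pol_minus_left)

lemma pol_zero_right: "pol x 0 = 0"
  using pol_diff_right[of x 0 0] by simp

lemma pol_zero_left: "pol 0 x = 0"
  using pol_diff_left[of 0 0 x] by simp

lemmas pol_bilinear =
  pol_add_right pol_add_left pol_scale_right pol_scale_left pol_minus_right pol_minus_left
  pol_diff_right pol_diff_left pol_zero_right pol_zero_left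

lemma pol_commute: "pol x y = pol y x"
  by (simp add: polar_def add.commute)

lemma norm_add: "n (x + y) = n x + n y + pol x y"
  by (simp add: polar_def)

lemma norm_minus: "n (- x) = n x"
  using norm_scale[of "-1" x] by simp

lemma norm_diff: "n (x - y) = n x + n y - pol x y"
  using norm_add[of x "- y"] by (simp add: norm_minus pol_minus_right)

lemma norm_zero: "n 0 = 0"
  using norm_scale[of 0 0] by simp

lemma pol_self: "pol x x = 2 * n x"
proof -
  have "n (x + x) = n ((1 + 1) *s x)" by (simp only: scale_left_distrib scale_one)
  then show ?thesis by (simp add: norm_scale polar_def power2_eq_square)
qed

text \<open>Nonsingularity as an extensionality principle: many vector identities below are proved
  by pairing both sides with an arbitrary vector.\<close>

lemma pol_eqI: "(\<And>z. pol x z = pol y z) \<Longrightarrow> x = y"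
  using nonsingular unfolding nonsingular_form_def by (metis pol_diff_left right_minus_eq)

lemma exists_nonzero: "\<exists>x::'c. x \<noteq> 0"
proof (rule ccontr)
  assume "\<not> ?thesis"
  then have "(UNIV :: 'c set) = {0}" by auto
  then have "dim UNIV = dim ({0} :: 'c set)" by simp
  moreover have "dim ({0} :: 'c set) \<le> card ({} :: 'c set)" by (intro dim_le_card) auto
  ultimately show False using dim_eq_8 by simp
qed

text \<open>Multiplicativity gives \<open>n one = (n one)\<^sup>2\<close>, and
  \<open>n one = 0\<close> would make \<open>n\<close>, hence its polar form, vanish identically on
  a nonzero space.\<close>

lemma norm_one: "n one = 1"
proof -
  have "n one \<noteq> 0"
  proof
    assume "n one = 0"
    then have "n x = 0" for x using norm_mult[of one x] by (simp add: one_mult)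
    then have "pol x z = pol 0 z" for x z by (simp add: polar_def)
    then have "x = 0" for x :: 'c using pol_eqI[of x 0] by blast
    then show False using exists_nonzero by blast
  qed
  then show ?thesis using norm_mult[of one one] by (simp add: one_mult)
qed

lemma one_neq_zero: "one \<noteq> 0"
  using norm_one norm_zero by auto

lemma pol_one_one: "pol one one = 2"
  by (simp add: pol_self norm_one)

lemma pol_mult_same_left: "pol (x \<cdot> y) (x \<cdot> z) = n x * pol y z"
  using norm_mult[of x "y + z"] by (simp add: mult_bilinear polar_def norm_mult algebra_simps)

lemma pol_mult_same_right: "pol (y \<cdot> x) (z \<cdot> x) = n x * pol y z"
  using norm_mult[of "y + z" x] by (simp add: mult_bilinear polar_def norm_mult algebra_simps)

text \<open>Polarizes \<open>pol_mult_same_left\<close> in the repeated factor. Putting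
  \<open>one\<close> for one argument yields the adjoints of left and right multiplications.\<close>

lemma pol_mult_exchange: "pol (x \<cdot> y) (z \<cdot> v) + pol (z \<cdot> y) (x \<cdot> v) = pol x z * pol y v"
  using pol_mult_same_left[of "x + z" y v]
  by (simp add: mult_bilinear pol_bilinear pol_mult_same_left norm_add algebra_simps)

lemma bar_eq: "bar x = pol x one *s one - x"
  by (simp add: conjugation_def)

lemma pol_mult_left: "pol (x \<cdot> y) z = pol y (bar x \<cdot> z)"
  using pol_mult_exchange[of x y one z]
  by (simp add: bar_eq mult_bilinear pol_bilinear algebra_simps)

lemma pol_mult_right: "pol (x \<cdot> y) z = pol x (z \<cdot> bar y)"
  using pol_mult_exchange[of x y z one]
  by (simp add: bar_eq mult_bilinear pol_bilinear algebra_simps pol_commute[of "z \<cdot> y" x])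

lemma bar_linear: "bar (x + y) = bar x + bar y" "bar (x - y) = bar x - bar y"
  "bar (- x) = - bar x" "bar (a *s x) = a *s bar x" "bar one = one"
  using scale_left_distrib[of 1 1 one]
  by (simp_all add: bar_eq pol_bilinear pol_one_one algebra_simps)

lemma pol_bar_one: "pol (bar x) one = pol x one"
  by (simp add: bar_eq pol_bilinear pol_one_one)

lemma bar_bar: "bar (bar x) = x"
  by (simp add: bar_eq[of "bar x"] pol_bar_one) (simp add: bar_eq)

lemma pol_bar: "pol (bar x) y = pol x (bar y)"
  by (simp add: bar_eq pol_bilinear algebra_simps pol_commute[of one])

lemma norm_bar: "n (bar x) = n x"
  by (simp add: bar_eq norm_diff norm_scale norm_one pol_bilinear power2_eq_square
      pol_commute[of one])

text \<open>Follows from \<open>pol_mult_exchange\<close> by taking adjoints. For orthogonal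
  \<open>x\<close> and \<open>z\<close> the right-hand side vanishes, and the resulting swap
  replaces associativity in the Cayley--Dickson rules.\<close>

lemma bar_mult_exchange: "bar x \<cdot> (z \<cdot> y) + bar z \<cdot> (x \<cdot> y) = pol x z *s y"
proof (rule pol_eqI)
  fix v
  have "pol (bar x \<cdot> (z \<cdot> y)) v = pol (z \<cdot> y) (x \<cdot> v)"
    "pol (bar z \<cdot> (x \<cdot> y)) v = pol (x \<cdot> y) (z \<cdot> v)"
    by (simp_all add: pol_mult_left[of "bar _"] bar_bar)
  then show "pol (bar x \<cdot> (z \<cdot> y) + bar z \<cdot> (x \<cdot> y)) v = pol (pol x z *s y) v"
    using pol_mult_exchange[of x y z v] by (simp add: pol_bilinear algebra_simps)
qed

lemma mult_bar_exchange: "(y \<cdot> x) \<cdot> bar z + (y \<cdot> z) \<cdot> bar x = pol x z *s y"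
proof (rule pol_eqI)
  fix v
  have "pol ((y \<cdot> x) \<cdot> bar z) v = pol (y \<cdot> x) (v \<cdot> z)"
    "pol ((y \<cdot> z) \<cdot> bar x) v = pol (y \<cdot> z) (v \<cdot> x)"
    by (simp_all add: pol_mult_right[of _ "bar _"] bar_bar)
  then show "pol ((y \<cdot> x) \<cdot> bar z + (y \<cdot> z) \<cdot> bar x) v = pol (pol x z *s y) v"
    using pol_mult_exchange[of y x v z]
    by (simp add: pol_bilinear algebra_simps pol_commute[of "v \<cdot> x"])
qed

lemma bar_mult_cancel: "bar x \<cdot> (x \<cdot> y) = n x *s y"
  by (rule pol_eqI) (simp add: pol_mult_left[of "bar x"] bar_bar pol_mult_same_left pol_bilinear)

lemma mult_bar_cancel: "(y \<cdot> x) \<cdot> bar x = n x *s y"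
  by (rule pol_eqI) (simp add: pol_mult_right[of _ "bar x"] bar_bar pol_mult_same_right pol_bilinear)

lemma bar_mult: "bar (x \<cdot> y) = bar y \<cdot> bar x"
proof (rule pol_eqI)
  fix z
  have "pol (bar (x \<cdot> y)) z = pol (bar x \<cdot> bar z) y"
    by (simp only: pol_bar pol_mult_left[of x] pol_commute[of y])
  also have "\<dots> = pol (bar y \<cdot> bar x) z"
    by (simp add: pol_mult_right[of "bar x"] pol_mult_left[of "bar y"] bar_bar)
  finally show "pol (bar (x \<cdot> y)) z = pol (bar y \<cdot> bar x) z" .
qed

text \<open>The degree-two equation of a composition algebra: \<open>bar_mult_cancel\<close> at
  \<open>y = one\<close>, with \<open>bar x\<close> expanded.\<close>

lemma square_eq: "x \<cdot> x = pol x one *s x - n x *s one"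
  using bar_mult_cancel[of x one] by (simp add: bar_eq mult_bilinear algebra_simps)

lemma mult_square_left: "x \<cdot> (x \<cdot> y) = pol x one *s (x \<cdot> y) - n x *s y"
  using bar_mult_cancel[of x y] by (simp add: bar_eq mult_bilinear algebra_simps)

lemma mult_square_right: "(y \<cdot> x) \<cdot> x = pol x one *s (y \<cdot> x) - n x *s y"
  using mult_bar_cancel[of y x] by (simp add: bar_eq mult_bilinear algebra_simps)

subsection \<open>Idempotents, para-units and automorphisms of the para-Cayley algebra\<close>

text \<open>Encoded through trace and norm, the data that the frame computations use;
  \<open>omega_elt_iff\<close> recovers the quadratic equation.\<close>

definition omega_elt :: "'c \<Rightarrow> bool" where
  "omega_elt w \<longleftrightarrow> w \<notin> range (\<lambda>a. a *s one) \<and> pol w one = - 1 \<and> n w = 1"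

lemma scalar_combination_eq_zero:
  assumes "w \<notin> range (\<lambda>a. a *s one)" and "a *s w + b *s one = 0"
  shows "a = 0 \<and> b = 0"
proof (cases "a = 0")
  case True
  then show ?thesis using assms(2) one_neq_zero by simp
next
  case False
  have "a *s w = (- b) *s one" using assms(2) by (simp add: add_eq_0_iff2)
  then have "inverse a *s a *s w = inverse a *s (- b) *s one" by simp
  then have "w = (inverse a * - b) *s one" using False by simp
  then show ?thesis using assms(1) by blast
qed

lemma omega_elt_iff:
  "omega_elt w \<longleftrightarrow> w \<notin> range (\<lambda>a. a *s one) \<and> w \<cdot> w + w + one = 0"
proof -
  have "w \<cdot> w + w + one = (pol w one + 1) *s w + (1 - n w) *s one"
    by (simp add: square_eq algebra_simps)
  moreover have "pol w one + 1 = 0 \<and> 1 - n w = 0 \<longleftrightarrow> pol w one = - 1 \<and> n w = 1"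
    by (auto simp: add_eq_0_iff2)
  ultimately show ?thesis
    unfolding omega_elt_def using scalar_combination_eq_zero
    by (metis add_0 scale_zero_left)
qed

lemma omega_elt_bar: "omega_elt w \<Longrightarrow> bar w = - one - w"
  by (simp add: bar_eq omega_elt_def)

abbreviation bullet :: "'c \<Rightarrow> 'c \<Rightarrow> 'c" where
  "bullet \<equiv> para_mult scale cmult one n"

lemma bullet_eq: "bullet x y = bar x \<cdot> bar y"
  by (simp add: para_mult_def)

lemma idempotents_bullet: "idempotents bullet = {one} \<union> {w. omega_elt w}"
proof -
  \<comment> \<open>The degree-two equation for \<open>bar e\<close> puts the para-square into the
    span of \<open>one\<close> and \<open>e\<close>. For nonscalar \<open>e\<close>, idempotency
    therefore splits into two scalar equations.\<close>
  have square: "bullet e e = ((pol e one)\<^sup>2 - n e) *s one - pol e one *s e" for e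
    by (simp add: bullet_eq square_eq pol_bar_one norm_bar)
      (simp add: bar_eq algebra_simps power2_eq_square)
  have "e = one \<or> omega_elt e" if e: "e \<noteq> 0" "bullet e e = e" for e
  proof (cases "e \<in> range (\<lambda>a. a *s one)")
    case True
    then obtain a where a: "e = a *s one" by blast
    then have "(a * a) *s one = a *s one"
      using e(2) by (simp add: bullet_eq bar_linear mult_bilinear)
    then have "(a * a - a) *s one = 0" by (simp only: scale_left_diff_distrib diff_self)
    then have "a * (a - 1) = 0" using one_neq_zero by (simp add: algebra_simps)
    then show ?thesis using a e(1) by auto
  next
    case False
    have "(pol e one + 1) *s e + (n e - (pol e one)\<^sup>2) *s one = e - bullet e e"
      by (simp add: square algebra_simps)
    then have "pol e one + 1 = 0 \<and> n e - (pol e one)\<^sup>2 = 0"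
      using e(2) by (intro scalar_combination_eq_zero[OF False]) simp
    then show ?thesis using False by (auto simp: omega_elt_def add_eq_0_iff2)
  qed
  moreover have "one \<in> idempotents bullet"
    using one_neq_zero by (simp add: idempotents_def bullet_eq bar_linear mult_bilinear)
  moreover have "e \<in> idempotents bullet" if "omega_elt e" for e
    using that norm_zero square[of e] by (auto simp: idempotents_def omega_elt_def)
  ultimately show ?thesis by (auto simp: idempotents_def)
qed

lemma omega_elt_neq_one: "omega_elt w \<Longrightarrow> w \<noteq> one"
  unfolding omega_elt_def by (metis rangeI scale_one)

section \<open>Vectors orthogonal to finite sets\<close>

text \<open>Induction on \<open>S\<close>. Either \<open>s\<close> imposes no new condition on
  vectors orthogonal to \<open>S\<close>, or some \<open>v0\<close> orthogonal to \<open>S\<close>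
  but not to \<open>s\<close> exists; then \<open>z\<close> is corrected by a multiple of
  \<open>s\<close>, and each test vector by a multiple of \<open>v0\<close>.\<close>

lemma double_orthogonal_in_span:
  assumes "finite S" and "\<And>v. (\<And>s. s \<in> S \<Longrightarrow> pol s v = 0) \<Longrightarrow> pol z v = 0"
  shows "z \<in> span S"
  using assms
proof (induction S arbitrary: z rule: finite_induct)
  case empty
  then have "z = 0" by (intro pol_eqI) (simp add: pol_zero_left)
  then show ?case by simp
next
  case (insert s S)
  show ?case
  proof (cases "\<forall>v. (\<forall>t\<in>S. pol t v = 0) \<longrightarrow> pol s v = 0")
    case True
    then have "z \<in> span S" using insert.prems by (intro insert.IH) auto
    then show ?thesis by (meson span_mono subset_insertI subsetD)
  next
    case False
    then obtain v0 where v0: "\<And>t. t \<in> S \<Longrightarrow> pol t v0 = 0" "pol s v0 \<noteq> 0" by blast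
    define c where "c = pol z v0 / pol s v0"
    have "z - c *s s \<in> span S"
    proof (rule insert.IH)
      fix v assume v: "\<And>t. t \<in> S \<Longrightarrow> pol t v = 0"
      let ?v = "v - (pol s v / pol s v0) *s v0"
      have "pol z ?v = 0"
        using v v0 by (intro insert.prems) (auto simp: pol_bilinear)
      then show "pol (z - c *s s) v = 0"
        by (simp add: pol_bilinear c_def)
    qed
    then show ?thesis by (auto simp: span_breakdown_eq)
  qed
qed

lemma exists_orthogonal:
  assumes "finite S" and "card S < 8"
  obtains v where "v \<noteq> 0" and "\<And>s. s \<in> S \<Longrightarrow> pol s v = 0"
proof -
  have "\<exists>v. v \<noteq> 0 \<and> (\<forall>s\<in>S. pol s v = 0)"
  proof (rule ccontr)
    assume "\<not> ?thesis"
    then have "z \<in> span S" for z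
      using double_orthogonal_in_span[OF assms(1), of z] pol_zero_right by metis
    then have "dim UNIV \<le> card S" by (intro dim_le_card) (use assms(1) in auto)
    then show False using dim_eq_8 assms(2) by simp
  qed
  then show ?thesis using that by blast
qed

section \<open>Uniqueness of the para-unit and comparison of automorphism groups\<close>

lemma para_units_bullet: "para_units scale bullet n = {one}"
proof -
  have "one \<in> para_units scale bullet n"
    by (auto simp: para_units_def idempotents_bullet bullet_eq bar_linear mult_bilinear)
      (simp_all add: bar_eq pol_commute)
  moreover have False if w: "omega_elt w" "w \<in> para_units scale bullet n" for w
  proof -
    have nw: "n w = 1" "pol w one = - 1" using w(1) by (auto simp: omega_elt_def)
    \<comment> \<open>Comparing norms of the two sides of the para-unit equation, with \<open>bar x\<close> subtracted,
      expresses \<open>3 n\<close> through two linear forms.\<close>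
    have key: "3 * n x = (pol w x)\<^sup>2 + pol w x * pol one x + (pol one x)\<^sup>2" for x
    proof -
      have "bar w \<cdot> bar x = pol w x *s w - x"
        using w(2) by (simp add: para_units_def bullet_eq)
      then have "(bar w - one) \<cdot> bar x = pol w x *s w - pol one x *s one"
        by (simp add: mult_diff_left one_mult) (simp add: bar_eq pol_commute)
      then have "n ((bar w - one) \<cdot> bar x) = n (pol w x *s w - pol one x *s one)" by simp
      then have "n (bar w - one) * n x = (pol w x)\<^sup>2 + pol w x * pol one x + (pol one x)\<^sup>2"
        by (simp add: norm_mult norm_bar norm_diff[of "_ *s _"] norm_scale nw norm_one pol_bilinear)
      moreover have "n (bar w - one) = 3"
        by (simp add: norm_diff norm_bar nw norm_one pol_bar_one)
      ultimately show ?thesis by simp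
    qed
    show False
    proof (cases "(3::'f) = 0")
      case True
      \<comment> \<open>When \<open>3 = 0\<close>, the right-hand side of \<open>key\<close> is the
        square of \<open>pol w x - pol one x\<close>.\<close>
      have "pol w x = pol one x" for x
      proof -
        have "(pol w x - pol one x)\<^sup>2 =
            (pol w x)\<^sup>2 + pol w x * pol one x + (pol one x)\<^sup>2 - 3 * (pol w x * pol one x)"
          by algebra
        then have "(pol w x - pol one x)\<^sup>2 = 0" using key[of x] True by simp
        then show ?thesis by simp
      qed
      then have "w = one" by (rule pol_eqI)
      then show False using omega_elt_neq_one w(1) by blast
    next
      case False
      \<comment> \<open>Adding a vector orthogonal to \<open>one\<close> and \<open>w\<close> does
        not change the right-hand side of \<open>key\<close>, so such a vector lies in the radical
        of the polar form.\<close>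
      have "card {one, w} < 8" by (rule le_less_trans[OF card_insert_le_m1[of 2]]) auto
      then obtain v where v: "v \<noteq> 0" "\<And>s. s \<in> {one, w} \<Longrightarrow> pol s v = 0"
        using exists_orthogonal[of "{one, w}"] by blast
      have "3 * pol v y = 0" for y
      proof -
        have "3 * pol v y = 3 * n (v + y) - 3 * n v - 3 * n y"
          by (simp add: norm_add algebra_simps)
        also have "\<dots> = 0" unfolding key using v(2) by (simp add: pol_bilinear)
        finally show ?thesis .
      qed
      then have "v = 0" using False by (intro pol_eqI) (simp add: pol_zero_left)
      then show False using v(1) by blast
    qed
  qed
  moreover have "para_units scale bullet n \<subseteq> idempotents bullet"
    by (auto simp: para_units_def)
  ultimately show ?thesis using idempotents_bullet by blast
qed

lemma Aut_map_one:
  assumes "\<phi> \<in> Aut scale cmult n"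
  shows "\<phi> one = one"
proof -
  obtain x where "\<phi> x = one" using assms bij_pointE[of \<phi> one] by (auto simp: Aut_def)
  then have "one = \<phi> (one \<cdot> x)" by (simp add: one_mult)
  also have "\<dots> = \<phi> one \<cdot> \<phi> x" using assms by (simp add: Aut_def)
  finally show ?thesis by (simp add: \<open>\<phi> x = one\<close> mult_one)
qed

lemma isometry_map_bar:
  assumes "Vector_Spaces.linear scale scale \<phi>" and "\<And>x. n (\<phi> x) = n x" and "\<phi> one = one"
  shows "\<phi> (bar x) = bar (\<phi> x)"
proof -
  interpret \<phi>: Vector_Spaces.linear scale scale \<phi> by fact
  have "pol (\<phi> x) one = pol x one"
    using assms(2)[of "x + one"] assms(2,3) by (simp add: polar_def \<phi>.add)
  then show ?thesis by (simp add: bar_eq \<phi>.diff \<phi>.scale assms(3))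
qed

lemma mult_eq_bullet: "x \<cdot> y = bullet (bar x) (bar y)"
  by (simp add: bullet_eq bar_bar)

text \<open>Each product is the other one twisted by \<open>bar\<close>, so it suffices that an
  isometric automorphism commutes with \<open>bar\<close>, which holds once it fixes
  \<open>one\<close>. For \<open>bullet\<close> this comes from the uniqueness of the para-unit,
  since automorphisms preserve para-units.\<close>

lemma Aut_bullet: "Aut scale bullet n = Aut scale cmult n"
proof (intro equalityI subsetI)
  fix \<phi> assume \<phi>: "\<phi> \<in> Aut scale cmult n"
  then have "\<phi> (bar x) = bar (\<phi> x)" for x
    by (intro isometry_map_bar Aut_map_one) (auto simp: Aut_def)
  then show "\<phi> \<in> Aut scale bullet n" using \<phi> by (simp add: Aut_def bullet_eq)
next
  fix \<phi> assume \<phi>: "\<phi> \<in> Aut scale bullet n"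
  then interpret \<phi>: Vector_Spaces.linear scale scale \<phi> by (simp add: Aut_def)
  have mult: "\<phi> (bullet x y) = bullet (\<phi> x) (\<phi> y)" and norm: "n (\<phi> x) = n x" for x y
    using \<phi> by (auto simp: Aut_def)
  have pol: "pol (\<phi> x) (\<phi> y) = pol x y" for x y
    using norm[of "x + y"] norm by (simp add: polar_def \<phi>.add)
  have surj: "\<exists>x. y = \<phi> x" for y using \<phi> bij_pointE[of \<phi> y] by (auto simp: Aut_def)
  have unit: "one \<in> para_units scale bullet n" using para_units_bullet by simp
  have "\<phi> one \<in> para_units scale bullet n"
  proof -
    have "bullet (\<phi> one) y = pol (\<phi> one) y *s \<phi> one - y \<and>
        bullet y (\<phi> one) = pol (\<phi> one) y *s \<phi> one - y" for y
    proof -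
      obtain x where "y = \<phi> x" using surj by blast
      then show ?thesis
        using unit by (simp add: mult[symmetric] pol para_units_def \<phi>.diff \<phi>.scale)
    qed
    moreover have "\<phi> one \<in> idempotents bullet"
      using unit norm_one norm_zero norm[of one]
      by (auto simp: para_units_def idempotents_def mult[symmetric])
    ultimately show ?thesis by (simp add: para_units_def)
  qed
  then have "\<phi> one = one" using para_units_bullet by simp
  then have "\<phi> (bar x) = bar (\<phi> x)" for x
    by (intro isometry_map_bar) (use norm \<phi>.linear_axioms in auto)
  then have "\<phi> (x \<cdot> y) = \<phi> x \<cdot> \<phi> y" for x y by (simp add: mult_eq_bullet mult)
  then show "\<phi> \<in> Aut scale cmult n" using \<phi> by (simp add: Aut_def)
qed

end

subsection \<open>Coordinates with respect to a generating triple\<close>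

type_synonym 'f quad = "'f \<times> 'f \<times> 'f \<times> 'f"

text \<open>
  Structure constants, with respect to \<open>1, w, p, wp\<close>, of the quaternion algebra generated by
  \<open>w\<close> and \<open>p\<close> with \<open>n(w) = 1\<close>, \<open>n(w,1) = -1\<close>, \<open>n(p) = \<nu>\<close>, \<open>n(p,1) = 0\<close>, \<open>n(w,p) = \<sigma>\<close>, and of
  its Cayley--Dickson double by an element of norm \<open>\<mu>\<close>.
\<close>

fun qmul :: "'f::field \<Rightarrow> 'f \<Rightarrow> 'f quad \<Rightarrow> 'f quad \<Rightarrow> 'f quad" where
  "qmul \<sigma> \<nu> (a, b, c, d) (a', b', c', d') =
    (a * a' - b * b' - \<sigma> * c * b' - \<nu> * c * c' + \<nu> * c * d' - \<nu> * d * d',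
     a * b' + b * a' - b * b' + \<nu> * c * d' - \<sigma> * d * b' - \<nu> * d * c',
     a * c' - b * d' + c * a' - c * b' - \<sigma> * c * d' + d * b',
     a * d' + b * c' - b * d' - c * b' + d * a' - \<sigma> * d * d')"

fun qbar :: "'f::field \<Rightarrow> 'f quad \<Rightarrow> 'f quad" where
  "qbar \<sigma> (a, b, c, d) = (a - b - \<sigma> * d, - b, - c, - d)"

fun qscale :: "'f::field \<Rightarrow> 'f quad \<Rightarrow> 'f quad" where
  "qscale r (a, b, c, d) = (r * a, r * b, r * c, r * d)"

fun qnorm :: "'f::field \<Rightarrow> 'f \<Rightarrow> 'f quad \<Rightarrow> 'f" where
  "qnorm \<sigma> \<nu> (a, b, c, d) =
    a\<^sup>2 + b\<^sup>2 + \<nu> * c\<^sup>2 + \<nu> * d\<^sup>2 - a * b - \<sigma> * a * d + \<sigma> * b * c - \<nu> * c * d"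

fun omul :: "'f::field \<Rightarrow> 'f \<Rightarrow> 'f \<Rightarrow> 'f quad \<times> 'f quad \<Rightarrow> 'f quad \<times> 'f quad \<Rightarrow> 'f quad \<times> 'f quad"
  where
  "omul \<sigma> \<nu> \<mu> (x, y) (x', y') =
    (qmul \<sigma> \<nu> x x' + qscale (- \<mu>) (qmul \<sigma> \<nu> (qbar \<sigma> y') y),
     qmul \<sigma> \<nu> y' x + qmul \<sigma> \<nu> y (qbar \<sigma> x'))"

text \<open>The Gram determinant of \<open>one\<close>, \<open>w\<close>, \<open>p\<close>,
  \<open>w \<cdot> p\<close> for the polar form is the square of
  \<open>3 * \<nu> - \<sigma>\<^sup>2\<close>, so \<open>disc\<close> makes their span
  nondegenerate.\<close>

locale cayley_pair = cayley_algebra scale cmult one n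
  for scale :: "'f::field \<Rightarrow> 'c::ab_group_add \<Rightarrow> 'c" and cmult one n +
  fixes w p :: 'c and \<sigma> \<nu> :: 'f
  assumes omega: "omega_elt w"
    and pol_p_one: "pol p one = 0"
    and norm_p: "n p = \<nu>"
    and pol_w_p: "pol w p = \<sigma>"
    and disc: "3 * \<nu> - \<sigma>\<^sup>2 \<noteq> 0"
begin

lemma norm_w: "n w = 1" and pol_w_one: "pol w one = - 1"
  using omega by (auto simp: omega_elt_def)

lemma bar_w: "bar w = - one - w"
  using omega by (rule omega_elt_bar)

lemma bar_p: "bar p = - p"
  by (simp add: bar_eq pol_p_one)

lemma pol_wp_one: "pol (w \<cdot> p) one = - \<sigma>"
  by (simp add: pol_mult_left bar_w mult_bilinear pol_bilinear pol_p_one pol_commute[of p w] pol_w_p)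

lemma pol_wp_w: "pol (w \<cdot> p) w = 0"
  using pol_mult_same_left[of w p one] by (simp add: mult_one pol_p_one)

lemma pol_wp_p: "pol (w \<cdot> p) p = - \<nu>"
  using pol_mult_same_right[of w p one] by (simp add: one_mult pol_w_one norm_p)

lemma norm_wp: "n (w \<cdot> p) = \<nu>"
  by (simp add: norm_mult norm_w norm_p)

lemmas pol_table =
  pol_one_one pol_w_one pol_p_one pol_w_p pol_wp_one pol_wp_w pol_wp_p
  pol_w_one[unfolded pol_commute[of w]] pol_p_one[unfolded pol_commute[of p]]
  pol_w_p[unfolded pol_commute[of w]] pol_wp_one[unfolded pol_commute[of "w \<cdot> p"]]
  pol_wp_w[unfolded pol_commute[of "w \<cdot> p"]] pol_wp_p[unfolded pol_commute[of "w \<cdot> p"]]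
  pol_self norm_one norm_w norm_p norm_wp

lemma mult_w_w: "w \<cdot> w = - w - one"
  by (simp add: square_eq pol_w_one norm_w)

lemma mult_p_p: "p \<cdot> p = (- \<nu>) *s one"
  by (simp add: square_eq pol_p_one norm_p)

text \<open>The exchange identity at \<open>one\<close> polarizes the degree-two equation and so
  expresses \<open>p \<cdot> w + w \<cdot> p\<close> through \<open>p\<close> and
  \<open>one\<close>.\<close>

lemma mult_p_w: "p \<cdot> w = (- \<sigma>) *s one - p - w \<cdot> p"
proof -
  have "p \<cdot> w + (w \<cdot> p + \<sigma> *s one) = - p"
    using bar_mult_exchange[of "bar w" "bar p" one]
    by (simp add: bar_bar mult_bilinear bar_p bar_w bar_linear pol_bilinear pol_table algebra_simps)
  then have "p \<cdot> w = - p - (w \<cdot> p + \<sigma> *s one)" by (simp add: eq_diff_eq)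
  then show ?thesis by simp
qed

lemma mult_w_wp: "w \<cdot> (w \<cdot> p) = - (w \<cdot> p) - p"
  by (simp add: mult_square_left pol_w_one norm_w)

lemma mult_wp_p: "(w \<cdot> p) \<cdot> p = (- \<nu>) *s w"
  by (simp add: mult_square_right pol_p_one norm_p)

lemma mult_p_wp: "p \<cdot> (w \<cdot> p) = \<nu> *s one + \<nu> *s w - \<sigma> *s p"
  using bar_mult_exchange[of p w p]
  by (simp add: mult_bilinear bar_p bar_w mult_p_p pol_table algebra_simps)

lemma mult_wp_w: "(w \<cdot> p) \<cdot> w = p - \<sigma> *s w"
  using mult_bar_exchange[of w p "bar w"]
  by (simp add: bar_bar bar_p mult_bilinear)
    (simp add: bar_w mult_w_w mult_bilinear pol_bilinear pol_table algebra_simps)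

lemma mult_wp_wp: "(w \<cdot> p) \<cdot> (w \<cdot> p) = (- \<sigma>) *s (w \<cdot> p) - \<nu> *s one"
  by (simp add: square_eq[of "w \<cdot> p"] pol_wp_one norm_wp)

lemmas mult_table =
  mult_w_w mult_p_p mult_p_w mult_w_wp mult_wp_p mult_p_wp mult_wp_w mult_wp_wp

fun quat :: "'f quad \<Rightarrow> 'c" where
  "quat (a, b, c, d) = a *s one + b *s w + c *s p + d *s (w \<cdot> p)"

lemma quat_add: "quat (x + y) = quat x + quat y"
  by (cases x; cases y) (simp add: algebra_simps)

lemma quat_scale: "quat (qscale r x) = r *s quat x"
  by (cases x) (simp add: algebra_simps)

lemma quat_mult: "quat x \<cdot> quat y = quat (qmul \<sigma> \<nu> x y)"
\<comment> \<open>Pairing with \<open>z\<close> leaves a scalar identity, which ring normalization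
  decides.\<close>
proof (rule pol_eqI)
  fix z
  obtain a b c d where x: "x = (a, b, c, d)" by (cases x)
  obtain a' b' c' d' where y: "y = (a', b', c', d')" by (cases y)
  show "pol (quat x \<cdot> quat y) z = pol (quat (qmul \<sigma> \<nu> x y)) z"
    unfolding x y quat.simps qmul.simps mult_bilinear mult_table pol_bilinear
    by (simp add: algebra_simps)
qed

lemma bar_quat: "bar (quat x) = quat (qbar \<sigma> x)"
  by (cases x) (simp add: bar_linear bar_eq[of w] bar_eq[of p] bar_eq[of "w \<cdot> p"] pol_table
      algebra_simps)

lemma norm_quat: "n (quat x) = qnorm \<sigma> \<nu> x"
  by (cases x) (simp add: norm_add norm_scale pol_bilinear pol_table algebra_simps)

lemma quat_generators: "quat (1, 0, 0, 0) = one" "quat (0, 1, 0, 0) = w" "quat (0, 0, 1, 0) = p"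
  "quat (0, 0, 0, 1) = w \<cdot> p"
  by simp_all

lemma quat_nondegenerate:
  assumes "\<And>y. pol (quat x) (quat y) = 0"
  shows "x = 0"
proof -
  obtain a b c d where x: "x = (a, b, c, d)" by (cases x)
  note q = x quat.simps pol_bilinear pol_table
  have 1: "2 * a - b - \<sigma> * d = 0"
    using assms[of "(1, 0, 0, 0)", unfolded quat_generators] by (simp add: q algebra_simps)
  have 2: "- a + 2 * b + \<sigma> * c = 0"
    using assms[of "(0, 1, 0, 0)", unfolded quat_generators] by (simp add: q algebra_simps)
  have 3: "\<sigma> * b + 2 * \<nu> * c - \<nu> * d = 0"
    using assms[of "(0, 0, 1, 0)", unfolded quat_generators] by (simp add: q algebra_simps)
  have 4: "- \<sigma> * a - \<nu> * c + 2 * \<nu> * d = 0"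
    using assms[of "(0, 0, 0, 1)", unfolded quat_generators] by (simp add: q algebra_simps)
  have "(3 * \<nu> - \<sigma>\<^sup>2) * a = 0" "(3 * \<nu> - \<sigma>\<^sup>2) * b = 0"
    "(3 * \<nu> - \<sigma>\<^sup>2) * c = 0" "(3 * \<nu> - \<sigma>\<^sup>2) * d = 0"
    using 1 2 3 4 by algebra+
  then show ?thesis using disc x by (simp add: zero_prod_def)
qed

lemma quat_orthogonalI:
  assumes "\<And>s. s \<in> {one, w, p, w \<cdot> p} \<Longrightarrow> pol s v = 0"
  shows "pol (quat x) v = 0"
  using assms by (cases x) (simp add: pol_bilinear)

text \<open>The complement of a nondegenerate subspace is nondegenerate, so it contains
  \<open>v\<close>, \<open>v'\<close> that are not orthogonal to each other; one of
  \<open>v\<close>, \<open>v'\<close>, \<open>v + v'\<close> then has nonzero norm.\<close>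

lemma exists_nonisotropic_orthogonal:
  obtains v where "n v \<noteq> 0" and "\<And>x. pol (quat x) v = 0"
proof -
  let ?S = "{one, w, p, w \<cdot> p}"
  have "card ?S < 8" using card_length[of "[one, w, p, w \<cdot> p]"] by simp
  then obtain v where v: "v \<noteq> 0" "\<And>s. s \<in> ?S \<Longrightarrow> pol s v = 0"
    using exists_orthogonal[of ?S] by blast
  \<comment> \<open>Otherwise \<open>v\<close> would lie in the span of the four generators and be
    orthogonal to all of it.\<close>
  obtain v' where v': "\<And>s. s \<in> ?S \<Longrightarrow> pol s v' = 0" "pol v v' \<noteq> 0"
  proof (rule ccontr)
    assume "\<not> thesis"
    then have "v \<in> span ?S" using that by (intro double_orthogonal_in_span) auto
    then obtain a b c d where "v - a *s one - b *s w - c *s p = d *s (w \<cdot> p)"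
      by (auto simp: span_breakdown_eq)
    then have "v = quat (a, b, c, d)" by (simp add: algebra_simps)
    moreover from this have "(a, b, c, d) = 0"
      using quat_orthogonalI[OF v(2)] by (intro quat_nondegenerate) (simp add: pol_commute)
    ultimately show False using v(1) by (simp add: zero_prod_def)
  qed
  show ?thesis
  proof (cases "n v = 0 \<and> n v' = 0")
    case True
    then have "n (v + v') \<noteq> 0" using v'(2) by (simp add: norm_add)
    moreover have "pol (quat x) (v + v') = 0" for x
      using quat_orthogonalI[OF v(2)] quat_orthogonalI[OF v'(1)] by (simp add: pol_bilinear)
    ultimately show ?thesis using that by blast
  next
    case False
    then show ?thesis
      using that[of v] that[of v'] quat_orthogonalI[OF v(2)] quat_orthogonalI[OF v'(1)] by blast
  qed
qed

end

section \<open>Cayley--Dickson doubling of the quaternion subalgebra\<close>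

locale cayley_frame = cayley_pair scale cmult one n w p \<sigma> \<nu>
  for scale :: "'f::field \<Rightarrow> 'c::ab_group_add \<Rightarrow> 'c" and cmult one n w p \<sigma> \<nu> +
  fixes u :: 'c and \<mu> :: 'f
  assumes orth: "pol (quat x) u = 0"
    and norm_u: "n u = \<mu>"
    and norm_u_nonzero: "\<mu> \<noteq> 0"
begin

lemma orth_one: "pol u one = 0"
  using orth[of "(1, 0, 0, 0)"] by (simp add: pol_commute)

lemma orth_bar: "pol (bar (quat x)) u = 0"
  by (simp add: bar_quat orth)

lemma bar_u: "bar u = - u"
  by (simp add: bar_eq orth_one)

lemma quat_commute_u: "quat x \<cdot> u = u \<cdot> bar (quat x)"
  using mult_bar_exchange[of one "quat x" u] orth[of x] by (simp add: one_mult bar_u mult_bilinear)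

text \<open>Moving \<open>u\<close> to the left conjugates the quaternion it passes, the exchange
  identity lets \<open>quat x\<close> pass \<open>u\<close> as well, and conjugating the product
  back reverses the order of the factors.\<close>

lemma quat_mult_quat_u: "quat x \<cdot> (quat y \<cdot> u) = (quat y \<cdot> quat x) \<cdot> u"
proof -
  have "quat x \<cdot> (quat y \<cdot> u) = quat x \<cdot> (u \<cdot> bar (quat y))"
    by (simp add: quat_commute_u)
  also have "\<dots> = u \<cdot> (bar (quat x) \<cdot> bar (quat y))"
    using bar_mult_exchange[of "bar (quat x)" u "bar (quat y)"] orth_bar[of x]
    by (simp add: bar_bar bar_u mult_bilinear)
  also have "\<dots> = (quat y \<cdot> quat x) \<cdot> u"
    using quat_commute_u[of "qmul \<sigma> \<nu> y x"] by (simp add: quat_mult[symmetric] bar_mult)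
  finally show ?thesis .
qed

lemma quat_u_mult_quat: "(quat x \<cdot> u) \<cdot> quat y = (quat x \<cdot> bar (quat y)) \<cdot> u"
  using mult_bar_exchange[of "quat x" u "bar (quat y)"] orth_bar[of y]
  by (simp add: bar_bar bar_u mult_bilinear pol_commute[of u])

lemma pol_quat_u_quat: "pol (quat x \<cdot> u) (quat y) = 0"
  by (simp add: pol_mult_left bar_quat quat_mult pol_commute[of u] orth)

text \<open>The element \<open>quat x \<cdot> u\<close> has trace zero and is orthogonal to
  \<open>quat y\<close>, so the exchange identity brings both copies of \<open>u\<close> together,
  where they contribute \<open>- \<mu>\<close>.\<close>

lemma quat_u_mult_quat_u:
  "(quat x \<cdot> u) \<cdot> (quat y \<cdot> u) = (- \<mu>) *s (bar (quat y) \<cdot> quat x)"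
proof -
  have "bar (quat x \<cdot> u) = - (quat x \<cdot> u)"
    using pol_quat_u_quat[of x "(1, 0, 0, 0)"] by (simp add: bar_eq)
  then have "(quat x \<cdot> u) \<cdot> (quat y \<cdot> u) = bar (quat y) \<cdot> ((quat x \<cdot> u) \<cdot> u)"
    using bar_mult_exchange[of "quat x \<cdot> u" "quat y" u] pol_quat_u_quat[of x y]
    by (simp add: mult_bilinear)
  also have "(quat x \<cdot> u) \<cdot> u = (- \<mu>) *s quat x"
    by (simp add: mult_square_right orth_one norm_u)
  finally show ?thesis by (simp add: mult_bilinear)
qed

fun coord :: "'f quad \<times> 'f quad \<Rightarrow> 'c" where
  "coord (x, y) = quat x + quat y \<cdot> u"

lemma coord_mult: "coord x \<cdot> coord y = coord (omul \<sigma> \<nu> \<mu> x y)"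
  by (cases x rule: prod.exhaust; cases y rule: prod.exhaust)
    (simp add: mult_bilinear quat_mult_quat_u quat_u_mult_quat quat_u_mult_quat_u quat_add
      quat_scale quat_mult[symmetric] bar_quat[symmetric])

lemma norm_coord: "n (coord (x, y)) = qnorm \<sigma> \<nu> x + qnorm \<sigma> \<nu> y * \<mu>"
  using pol_quat_u_quat[of y x]
  by (simp add: norm_add norm_mult norm_quat norm_u pol_commute[of "quat x"])

lemma coord_add: "coord (x + y) = coord x + coord y"
  by (cases x rule: prod.exhaust; cases y rule: prod.exhaust) (simp add: quat_add mult_bilinear)

lemma coord_scale: "coord (map_prod (qscale r) (qscale r) x) = r *s coord x"
  by (cases x) (simp add: quat_scale mult_bilinear scale_right_distrib)

text \<open>Pairing with quaternions isolates the first component, because the second summand is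
  orthogonal to them; right multiplication by \<open>bar u\<close> then removes \<open>u\<close>
  from the second.\<close>

lemma coord_eq_zero:
  assumes "coord x = 0"
  shows "x = 0"
proof -
  obtain y z where x: "x = (y, z)" by (cases x)
  have "pol (quat y) (quat v) = pol (coord x) (quat v)" for v
    by (simp add: x pol_bilinear pol_quat_u_quat)
  then have y: "y = 0" using assms by (intro quat_nondegenerate) (simp add: pol_bilinear)
  then have "quat z \<cdot> u = 0" using assms x by (simp add: zero_prod_def)
  then have "\<mu> *s quat z = 0" using mult_bar_cancel[of "quat z" u] by (simp add: norm_u mult_bilinear)
  then have "quat z = 0" using norm_u_nonzero by simp
  then have "z = 0" by (intro quat_nondegenerate) (simp add: pol_bilinear)
  then show ?thesis using x y by (simp add: zero_prod_def)
qed

lemma coord_bij: "bij coord"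
proof (rule bijI)
  show inj: "inj coord"
  proof (rule injI)
    fix x y assume "coord x = coord y"
    then have "coord (x - y) = 0" using coord_add[of "x - y" y] by simp
    then show "x = y" using coord_eq_zero by fastforce
  qed
  \<comment> \<open>The standard basis of the coordinate space. Its image consists of eight
    independent vectors, which must span by dimension.\<close>
  define T :: "('f quad \<times> 'f quad) set" where
    "T = {((1,0,0,0),0), ((0,1,0,0),0), ((0,0,1,0),0), ((0,0,0,1),0),
          (0,(1,0,0,0)), (0,(0,1,0,0)), (0,(0,0,1,0)), (0,(0,0,0,1))}"
  have card: "card (coord ` T) = 8"
    by (subst card_image[OF inj_on_subset[OF inj]]) (auto simp: T_def zero_prod_def)
  have indep: "independent (coord ` T)"
  proof (rule independent_if_scalars_zero)
    fix f x assume f: "(\<Sum>x\<in>coord ` T. f x *s x) = 0" and x: "x \<in> coord ` T"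
    let ?f = "\<lambda>t. f (coord t)"
    have "(\<Sum>t\<in>T. ?f t *s coord t) = 0"
      using f by (subst (asm) sum.reindex[OF inj_on_subset[OF inj]]) auto
    then have "coord (
        (?f ((1,0,0,0),0), ?f ((0,1,0,0),0), ?f ((0,0,1,0),0), ?f ((0,0,0,1),0)),
        (?f (0,(1,0,0,0)), ?f (0,(0,1,0,0)), ?f (0,(0,0,1,0)), ?f (0,(0,0,0,1)))) = 0"
      by (simp add: T_def zero_prod_def mult_bilinear add.assoc)
    note zero = coord_eq_zero[OF this]
    have "?f t = 0" if "t \<in> T" for t
      using that zero by (auto simp: T_def zero_prod_def simp del: coord.simps)
    then show "f x = 0" using x by blast
  qed (simp add: T_def)
  obtain B where B: "B \<subseteq> UNIV" "independent B" "UNIV \<subseteq> span B" "card B = dim UNIV"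
    using basis_exists by blast
  then have "finite B" using dim_eq_8 by (simp add: card_ge_0_finite)
  then interpret fd: finite_dimensional_vector_space scale B
    using B by unfold_locales auto
  have "UNIV \<subseteq> span (coord ` T)"
    using card indep dim_eq_8 by (intro fd.card_ge_dim_independent) auto
  moreover have "span (coord ` T) \<subseteq> range coord"
  proof (rule span_minimal)
    show "subspace (range coord)"
    proof (rule subspaceI)
      show "0 \<in> range coord" by (rule range_eqI[of _ _ 0]) (simp add: zero_prod_def mult_bilinear)
      show "x + y \<in> range coord" if "x \<in> range coord" "y \<in> range coord" for x y
      proof -
        from that obtain x' y' where "x = coord x'" "y = coord y'" by blast
        then have "x + y = coord (x' + y')" by (simp only: coord_add)
        then show ?thesis by (rule range_eqI)
      qed
      show "r *s x \<in> range coord" if "x \<in> range coord" for r x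
      proof -
        from that obtain x' where "x = coord x'" by blast
        then have "r *s x = coord (map_prod (qscale r) (qscale r) x')" by (simp only: coord_scale)
        then show ?thesis by (rule range_eqI)
      qed
    qed
  qed auto
  ultimately show "surj coord" by blast
qed

end

text \<open>Multiplication and norm in frame coordinates depend only on \<open>\<sigma>\<close>,
  \<open>\<nu>\<close>, \<open>\<mu>\<close>, so matching the coordinates of the two frames is an
  automorphism.\<close>

lemma (in cayley_algebra) frames_conjugate:
  assumes "cayley_frame scale cmult one n w p \<sigma> \<nu> u \<mu>"
    and "cayley_frame scale cmult one n w' p' \<sigma> \<nu> u' \<mu>"
  shows "\<exists>\<phi>\<in>Aut scale cmult n. \<phi> w = w'"
proof -
  interpret A: cayley_frame scale cmult one n w p \<sigma> \<nu> u \<mu> by fact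
  interpret B: cayley_frame scale cmult one n w' p' \<sigma> \<nu> u' \<mu> by fact
  define \<phi> where "\<phi> = B.coord \<circ> inv A.coord"
  have \<phi>_coord: "\<phi> (A.coord x) = B.coord x" for x
    using A.coord_bij by (simp add: \<phi>_def bij_is_inj)
  have surj: "\<exists>y. x = A.coord y" for x using bij_pointE[OF A.coord_bij] by metis
  have "bij \<phi>" unfolding \<phi>_def by (intro bij_comp bij_imp_bij_inv A.coord_bij B.coord_bij)
  moreover have "\<phi> (x + y) = \<phi> x + \<phi> y" "\<phi> (x \<cdot> y) = \<phi> x \<cdot> \<phi> y" "\<phi> (r *s x) = r *s \<phi> x"
    "n (\<phi> x) = n x" for x y r
  proof -
    obtain x' y' where xy: "x = A.coord x'" "y = A.coord y'" using surj by metis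
    show "\<phi> (x + y) = \<phi> x + \<phi> y"
      unfolding xy A.coord_add[symmetric] \<phi>_coord B.coord_add ..
    show "\<phi> (x \<cdot> y) = \<phi> x \<cdot> \<phi> y"
      unfolding xy A.coord_mult \<phi>_coord B.coord_mult ..
    show "\<phi> (r *s x) = r *s \<phi> x"
      unfolding xy A.coord_scale[symmetric] \<phi>_coord B.coord_scale ..
    show "n (\<phi> x) = n x"
      unfolding xy \<phi>_coord by (cases x') (simp only: A.norm_coord B.norm_coord)
  qed
  then have "Vector_Spaces.linear scale scale \<phi>"
    by (simp add: linear_iff_module_hom module_hom_iff module_axioms)
  ultimately have "\<phi> \<in> Aut scale cmult n"
    using \<open>\<And>y x. \<phi> (x \<cdot> y) = \<phi> x \<cdot> \<phi> y\<close> \<open>\<And>x. n (\<phi> x) = n x\<close> by (simp add: Aut_def)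
  moreover have "\<phi> w = w'"
    using \<phi>_coord[of "((0, 1, 0, 0), (0, 0, 0, 0))"] by (simp add: mult_bilinear)
  ultimately show ?thesis by blast
qed

subsection \<open>Conjugacy and existence of the other idempotents\<close>

context cayley_algebra
begin

text \<open>Take \<open>x\<close> isotropic and \<open>y\<close> orthogonal to \<open>one\<close>
  and \<open>x\<close>. Either \<open>y\<close> is isotropic, or \<open>y\<close> is invertible and
  \<open>x \<cdot> y\<close> is a nonzero isotropic vector with trace
  \<open>pol y (bar x) = 0\<close>.\<close>

lemma isotropic_orthogonal_one:
  assumes "isotropic_form n"
  obtains z where "z \<noteq> 0" "n z = 0" "pol z one = 0"
proof -
  obtain x where x: "x \<noteq> 0" "n x = 0" using assms by (auto simp: isotropic_form_def)
  have "card {one, x} < 8" using card_length[of "[one, x]"] by simp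
  then obtain y where y: "y \<noteq> 0" "\<And>s. s \<in> {one, x} \<Longrightarrow> pol s y = 0"
    using exists_orthogonal[of "{one, x}"] by blast
  show ?thesis
  proof (cases "n y = 0")
    case True
    then show ?thesis using that[of y] y by (simp add: pol_commute)
  next
    case False
    have "(x \<cdot> y) \<cdot> bar y \<noteq> 0" using False x(1) by (simp add: mult_bar_cancel)
    then have "x \<cdot> y \<noteq> 0" by (auto simp: mult_bilinear)
    moreover have "pol (x \<cdot> y) one = 0"
      using y(2) by (simp add: pol_mult_left bar_eq mult_bilinear pol_bilinear pol_commute[of y])
    ultimately show ?thesis using that[of "x \<cdot> y"] x(2) by (simp add: norm_mult)
  qed
qed

lemma exists_orthogonal_one_not_orthogonal:
  assumes "z \<notin> range (\<lambda>a. a *s one)"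
  obtains y where "pol one y = 0" "pol z y \<noteq> 0"
  using assms double_orthogonal_in_span[of "{one}" z] by (auto simp: span_singleton)

lemma isotropic_pair:
  assumes "isotropic_form n" and "omega_elt w"
  obtains p where "n p = 0" "pol p one = 0" "pol w p = 1"
proof -
  obtain z where z: "z \<noteq> 0" "n z = 0" "pol z one = 0"
    using isotropic_orthogonal_one[OF assms(1)] .
  have "z \<notin> range (\<lambda>a. a *s one)" using z(1,2) by (auto simp: norm_scale norm_one)
  then obtain y1 where y1: "pol one y1 = 0" "pol z y1 \<noteq> 0"
    by (rule exists_orthogonal_one_not_orthogonal)
  obtain y2 where y2: "pol one y2 = 0" "pol w y2 \<noteq> 0"
    using assms(2) exists_orthogonal_one_not_orthogonal[of w] by (auto simp: omega_elt_def)
  \<comment> \<open>The complement of \<open>one\<close> is not the union of two proper subspaces: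
    if neither \<open>y1\<close> nor \<open>y2\<close> serves, their sum does.\<close>
  obtain y where y: "pol one y = 0" "pol z y \<noteq> 0" "pol w y \<noteq> 0"
  proof (cases "pol w y1 = 0 \<and> pol z y2 = 0")
    case True
    then show ?thesis using that[of "y1 + y2"] y1 y2 by (simp add: pol_bilinear)
  next
    case False
    then show ?thesis using that[of y1] that[of y2] y1 y2 by blast
  qed
  \<comment> \<open>Up to a scalar, the image of \<open>z\<close> under the reflection along \<open>y\<close>.\<close>
  define z' where "z' = (if pol w z = 0 then n y *s z - pol z y *s y else z)"
  have "n z' = 0"
    by (simp add: z'_def norm_diff norm_scale pol_bilinear z(2) power2_eq_square)
  moreover have "pol z' one = 0"
    using y(1) z(3) by (simp add: z'_def pol_bilinear pol_commute)
  moreover have c: "pol w z' \<noteq> 0"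
    using y by (simp add: z'_def pol_bilinear)
  ultimately show ?thesis
    using that[of "inverse (pol w z') *s z'"] by (simp add: norm_scale pol_bilinear)
qed

text \<open>With \<open>\<sigma> = 1\<close> and \<open>\<nu> = 0\<close>, \<open>disc\<close> reads
  \<open>- 1 \<noteq> 0\<close> in every characteristic, and the quaternion norm takes every value,
  so the doubling element can be rescaled to norm 1.\<close>

lemma isotropic_frame:
  assumes "isotropic_form n" and "omega_elt w"
  shows "\<exists>p u. cayley_frame scale cmult one n w p 1 0 u 1"
proof -
  obtain p where p: "n p = 0" "pol p one = 0" "pol w p = 1" using isotropic_pair[OF assms] .
  interpret P: cayley_pair scale cmult one n w p 1 0
    by unfold_locales (use p assms(2) in auto)
  obtain v where v: "n v \<noteq> 0" "\<And>x. pol (P.quat x) v = 0"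
    using P.exists_nonisotropic_orthogonal by blast
  \<comment> \<open>Here \<open>qnorm 1 0 (0, 1, c, 0) = 1 + c\<close>, so \<open>q\<close> has norm
    \<open>inverse (n v)\<close>; multiplication by \<open>q\<close> keeps \<open>v\<close>
    orthogonal to the quaternions.\<close>
  define q where "q = P.quat (0, 1, inverse (n v) - 1, 0)"
  have "n q = inverse (n v)" unfolding q_def P.norm_quat by simp
  then have "n (q \<cdot> v) = 1" using v(1) by (simp add: norm_mult)
  moreover have "pol (P.quat x) (q \<cdot> v) = 0" for x
  proof -
    have "pol (P.quat x) (q \<cdot> v) = pol v (bar q \<cdot> P.quat x)"
      by (simp add: pol_commute[of "P.quat x"] pol_mult_left)
    also have "\<dots> = 0" unfolding q_def P.bar_quat P.quat_mult by (simp only: pol_commute[of v] v(2))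
    finally show ?thesis .
  qed
  ultimately have "cayley_frame scale cmult one n w p 1 0 (q \<cdot> v) 1"
    by unfold_locales auto
  then show ?thesis by blast
qed

lemma norm_omega_diff_one: "omega_elt w \<Longrightarrow> n (w - one) = 3"
  by (simp add: omega_elt_def norm_diff norm_one)

lemma anisotropic_frames:
  assumes "\<not> isotropic_form n" and "omega_elt w" and "omega_elt w'"
  shows "\<exists>p u \<nu> \<mu>. cayley_frame scale cmult one n w p 0 \<nu> u \<mu> \<and>
    cayley_frame scale cmult one n w' p 0 \<nu> u \<mu>"
proof -
  have aniso: "n x \<noteq> 0" if "x \<noteq> 0" for x using assms(1) that by (auto simp: isotropic_form_def)
  \<comment> \<open>The nonzero vector \<open>w - one\<close> has norm 3. With
    \<open>\<sigma> = 0\<close>, \<open>disc\<close> becomes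
    \<open>3 * n p \<noteq> 0\<close>.\<close>
  have three: "(3::'f) \<noteq> 0"
    using aniso[of "w - one"] norm_omega_diff_one[OF assms(2)] omega_elt_neq_one[OF assms(2)] by simp
  have "card {one, w, w'} < 8" using card_length[of "[one, w, w']"] by simp
  then obtain p where p: "p \<noteq> 0" "\<And>s. s \<in> {one, w, w'} \<Longrightarrow> pol s p = 0"
    using exists_orthogonal[of "{one, w, w'}"] by blast
  let ?S = "{one, p, w, w \<cdot> p, w', w' \<cdot> p}"
  have "card ?S < 8" using card_length[of "[one, p, w, w \<cdot> p, w', w' \<cdot> p]"] by simp
  then obtain u where u: "u \<noteq> 0" "\<And>s. s \<in> ?S \<Longrightarrow> pol s u = 0"
    using exists_orthogonal[of ?S] by blast
  have "cayley_frame scale cmult one n v p 0 (n p) u (n u)"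
    if v: "omega_elt v" "pol v p = 0" "pol v u = 0" "pol (v \<cdot> p) u = 0" for v
  proof -
    interpret P: cayley_pair scale cmult one n v p 0 "n p"
    proof unfold_locales
      show "pol p one = 0" using p(2)[of one] by (simp add: pol_commute)
      show "3 * n p - 0\<^sup>2 \<noteq> 0" using three aniso[OF p(1)] by simp
    qed (use v in simp_all)
    show ?thesis
    proof unfold_locales
      show "pol (P.quat x) u = 0" for x using v u(2) by (intro P.quat_orthogonalI) auto
    qed (use aniso[OF u(1)] in simp_all)
  qed
  then have "cayley_frame scale cmult one n w p 0 (n p) u (n u)"
    "cayley_frame scale cmult one n w' p 0 (n p) u (n u)"
    using assms(2,3) p(2) u(2) by auto
  then show ?thesis by blast
qed

lemma omega_elts_conjugate:
  assumes "omega_elt w" and "omega_elt w'"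
  shows "\<exists>\<phi>\<in>Aut scale cmult n. \<phi> w = w'"
proof (cases "isotropic_form n")
  case True
  then obtain p u p' u' where "cayley_frame scale cmult one n w p 1 0 u 1"
    "cayley_frame scale cmult one n w' p' 1 0 u' 1"
    using isotropic_frame[OF _ assms(1)] isotropic_frame[OF _ assms(2)] by blast
  then show ?thesis by (rule frames_conjugate)
next
  case False
  then obtain p u \<nu> \<mu> where "cayley_frame scale cmult one n w p 0 \<nu> u \<mu>"
    "cayley_frame scale cmult one n w' p 0 \<nu> u \<mu>"
    using anisotropic_frames[OF _ assms] by blast
  then show ?thesis by (rule frames_conjugate)
qed

text \<open>In characteristic 3 the vector \<open>w - one\<close> is isotropic. Conversely,
  \<open>one + z\<close> works for a nonzero isotropic \<open>z\<close> of trace zero, its trace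
  being \<open>2 = - 1\<close>.\<close>

lemma exists_omega_elt_char_3:
  assumes "(3::'f) = 0"
  shows "(\<exists>w. omega_elt w) \<longleftrightarrow> isotropic_form n"
proof
  assume "\<exists>w. omega_elt w"
  then obtain w where "omega_elt w" by blast
  then have "w - one \<noteq> 0" "n (w - one) = 0"
    using norm_omega_diff_one[of w] omega_elt_neq_one[of w] assms by simp_all
  then show "isotropic_form n" unfolding isotropic_form_def by blast
next
  assume "isotropic_form n"
  then obtain z where z: "z \<noteq> 0" "n z = 0" "pol z one = 0"
    by (rule isotropic_orthogonal_one)
  have "one + z \<noteq> a *s one" for a
  proof
    assume "one + z = a *s one"
    then have eq: "z = (a - 1) *s one" by (simp add: algebra_simps)
    then have "(a - 1)\<^sup>2 = 0" using z(2) by (simp add: norm_scale norm_one)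
    then show False using eq z(1) by simp
  qed
  moreover have "pol (one + z) one = - 1"
  proof -
    have "pol (one + z) one = 3 - 1" using z(3) by (simp add: pol_bilinear pol_one_one)
    then show ?thesis unfolding assms by simp
  qed
  moreover have "n (one + z) = 1"
    using z(2,3) by (simp add: norm_add norm_one pol_commute[of one])
  ultimately have "omega_elt (one + z)" unfolding omega_elt_def by blast
  then show "\<exists>w. omega_elt w" by blast
qed

end

section \<open>Subalgebras isomorphic to the algebra of \<open>X\<^sup>2 + X + 1\<close>\<close>

lemma omega_poly_mod:
  fixes a b c d :: "'f::field"
  shows "([:a, b:] * [:c, d:]) mod [:1, 1, 1:] = [:a * c - b * d, a * d + b * c - b * d:]"
proof -
  have "[:a, b:] * [:c, d:] = [:a * c - b * d, a * d + b * c - b * d:] + [:b * d:] * [:1, 1, 1:]"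
    by (simp add: algebra_simps)
  then have "([:a, b:] * [:c, d:]) mod [:1, 1, 1:] = [:a * c - b * d, a * d + b * c - b * d:] mod [:1, 1, 1:]"
    by (metis mod_mult_self1)
  also have "\<dots> = [:a * c - b * d, a * d + b * c - b * d:]"
    by (rule mod_poly_less) auto
  finally show ?thesis .
qed

lemma omega_alg_reduced:
  fixes k :: "'f::field omega_alg"
  obtains a b where "k = abs_omega_alg [:a, b:]"
proof -
  obtain P where P: "k = abs_omega_alg P" by (metis Quotient3_abs_rep Quotient3_omega_alg)
  define r where "r = P mod [:1, 1, 1:]"
  have "degree r < 2"
    using degree_mod_less'[of "[:1, 1, 1:]" P] by (cases "r = 0") (auto simp: r_def)
  then have "r = [:coeff r 0, coeff r 1:]"
    by (intro poly_eqI) (auto simp: coeff_pCons coeff_eq_0 split: nat.splits)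
  moreover have "k = abs_omega_alg r"
    unfolding P r_def omega_alg.abs_eq_iff minus_mod_eq_mult_div by (rule dvd_triv_left)
  ultimately show ?thesis using that by metis
qed

context cayley_algebra
begin

lemma omega_elt_imp_copy:
  assumes w: "omega_elt w"
  shows "contains_copy_of_omega_alg scale cmult"
proof -
  \<comment> \<open>Evaluation at \<open>w\<close> of remainders modulo \<open>[:1, 1, 1:]\<close>,
    which have degree below 2; reducing first makes \<open>\<phi>\<close> independent of the
    representative.\<close>
  define ev where "ev r = coeff r 0 *s one + coeff r 1 *s w" for r
  define \<phi> where "\<phi> k = ev (rep_omega_alg k mod [:1, 1, 1:])" for k :: "'f omega_alg"
  have abs: "\<phi> (abs_omega_alg P) = ev (P mod [:1, 1, 1:])" for P
  proof -
    have "[:1, 1, 1:] dvd rep_omega_alg (abs_omega_alg P) - P"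
      by (metis Quotient3_abs_rep Quotient3_omega_alg omega_alg.abs_eq_iff)
    then show ?thesis unfolding \<phi>_def by (metis mod_eq_dvd_iff)
  qed
  have \<phi>: "\<phi> (abs_omega_alg [:a, b:]) = a *s one + b *s w" for a b
    by (simp add: abs mod_poly_less ev_def)
  have add: "\<phi> (x + y) = \<phi> x + \<phi> y" and mult: "\<phi> (x * y) = \<phi> x \<cdot> \<phi> y"
    and scale: "\<phi> (scale_omega r x) = r *s \<phi> x" and zero: "\<phi> x = 0 \<Longrightarrow> x = 0" for x y r
  proof -
    obtain a b where x: "x = abs_omega_alg [:a, b:]" by (rule omega_alg_reduced)
    obtain c d where y: "y = abs_omega_alg [:c, d:]" by (rule omega_alg_reduced)
    show "\<phi> (x + y) = \<phi> x + \<phi> y"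
      by (simp add: x y plus_omega_alg.abs_eq \<phi> algebra_simps)
    show "\<phi> (scale_omega r x) = r *s \<phi> x"
      by (simp add: x scale_omega.abs_eq \<phi> algebra_simps)
    have sq: "w \<cdot> w = - w - one" using w by (simp add: omega_elt_def square_eq)
    have prod: "\<phi> (x * y) = (a * c - b * d) *s one + (a * d + b * c - b * d) *s w"
      unfolding x y times_omega_alg.abs_eq abs omega_poly_mod by (simp add: ev_def)
    show "\<phi> (x * y) = \<phi> x \<cdot> \<phi> y"
      unfolding prod unfolding x y \<phi> by (simp add: mult_bilinear sq algebra_simps)
    show "x = 0" if "\<phi> x = 0"
    proof -
      have "b = 0 \<and> a = 0"
        using that w by (intro scalar_combination_eq_zero[of w])
          (auto simp: x \<phi> omega_elt_def add.commute)
      then show ?thesis by (simp add: x zero_omega_alg_def)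
    qed
  qed
  have linear: "Vector_Spaces.linear scale_omega scale \<phi>"
    by (simp add: linear_iff_module_hom module_hom_iff module_axioms add scale
        module_iff_vector_space vector_space_axioms vector_space_scale_omega)
  then interpret \<phi>: Vector_Spaces.linear scale_omega scale \<phi> .
  have "inj \<phi>"
  proof (rule injI)
    fix x y assume "\<phi> x = \<phi> y"
    then have "\<phi> (x - y) = 0" by (simp add: \<phi>.diff)
    then show "x = y" using zero by fastforce
  qed
  moreover have "subalgebra scale cmult (range \<phi>)"
    unfolding subalgebra_def using \<phi>.subspace_image[OF \<phi>.vs1.subspace_UNIV]
    by (auto simp flip: mult)
  ultimately show ?thesis
    unfolding contains_copy_of_omega_alg_def using linear mult
    by (intro exI[of _ "range \<phi>"] conjI exI[of _ \<phi>]) (auto simp: bij_betw_def)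
qed

text \<open>The embedding is not assumed to be unital, so the work is to show that the image
  \<open>e\<close> of 1 is \<open>one\<close>; the image of \<open>X\<close> then satisfies the
  required equation.\<close>

lemma copy_imp_omega_elt:
  assumes "contains_copy_of_omega_alg scale cmult"
  shows "\<exists>w. omega_elt w"
proof -
  obtain \<phi> :: "'f omega_alg \<Rightarrow> 'c" and S where
    lin: "Vector_Spaces.linear scale_omega scale \<phi>" and bij: "bij_betw \<phi> UNIV S"
    and mult: "\<And>x y. \<phi> (x * y) = \<phi> x \<cdot> \<phi> y"
    using assms unfolding contains_copy_of_omega_alg_def by blast
  interpret \<phi>: Vector_Spaces.linear scale_omega scale \<phi> by fact
  have inj: "inj \<phi>" using bij by (simp add: bij_betw_def)
  define X :: "'f omega_alg" where "X = abs_omega_alg [:0, 1:]"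
  have XX: "X * X + X + 1 = 0"
    by (simp add: X_def times_omega_alg.abs_eq plus_omega_alg.abs_eq one_omega_alg_def
        zero_omega_alg_def omega_alg.abs_eq_iff one_pCons)
  have X_scalar: "X \<noteq> scale_omega c 1" for c
  proof
    assume "X = scale_omega c 1"
    then have "[:1, 1, 1:] dvd [:0, 1:] - smult c 1"
      by (simp add: X_def one_omega_alg_def scale_omega.abs_eq omega_alg.abs_eq_iff)
    then have "[:1, 1, 1:] dvd [:- c, 1:]" by (simp add: one_pCons)
    then have "degree [:1, 1, 1 :: 'f:] \<le> degree [:- c, 1:]" by (rule dvd_imp_degree_le) simp
    then show False by simp
  qed
  define e where "e = \<phi> 1"
  define w where "w = \<phi> X"
  have ee: "e \<cdot> e = e" and ew: "e \<cdot> w = w" by (simp_all add: e_def w_def flip: mult)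
  have ww: "w \<cdot> w + w + e = 0"
    using arg_cong[OF XX, of \<phi>] by (simp add: \<phi>.add mult e_def w_def \<phi>.zero)
  have e0: "e \<noteq> 0" using inj injD[OF inj, of 1 0] by (auto simp: e_def \<phi>.zero)
  have w_scalar: "w \<noteq> c *s e" for c
    using X_scalar[of c] injD[OF inj, of X "scale_omega c 1"] by (auto simp: e_def w_def \<phi>.scale)
  have "n e \<noteq> 0"
  proof
    \<comment> \<open>Then \<open>n w = 0\<close>, so \<open>w \<cdot> w\<close> is a multiple of
      \<open>w\<close>, and the equation \<open>ww\<close> makes \<open>w\<close> proportional to
      \<open>e\<close>, contradicting injectivity.\<close>
    assume "n e = 0"
    then have "n w = 0" using norm_mult[of e w] ew by simp
    then have eq: "(pol w one + 1) *s w + e = 0" using ww by (simp add: square_eq algebra_simps)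
    have t: "pol w one + 1 \<noteq> 0" using eq e0 by auto
    have "w = inverse (pol w one + 1) *s (pol w one + 1) *s w" using t by simp
    also have "(pol w one + 1) *s w = - e" using eq by (simp add: eq_neg_iff_add_eq_0)
    finally have "w = (- inverse (pol w one + 1)) *s e" by simp
    then show False using w_scalar by blast
  qed
  \<comment> \<open>An idempotent of nonzero norm can be cancelled by right multiplication with
    \<open>bar e\<close>.\<close>
  then have "e = one"
    using mult_bar_cancel[of e e] mult_bar_cancel[of one e] ee by (simp add: one_mult)
  then have "omega_elt w" using ww w_scalar by (auto simp: omega_elt_iff)
  then show ?thesis by blast
qed

lemma conj_class_omega_elt:
  assumes "omega_elt w"
  shows "conj_class (Aut scale bullet n) w = {w. omega_elt w}"
proof -
  have "omega_elt (\<phi> w)" if "\<phi> \<in> Aut scale bullet n" for \<phi>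
  proof -
    interpret \<phi>: Vector_Spaces.linear scale scale \<phi> using that by (simp add: Aut_def)
    have "inj \<phi>" and one: "\<phi> one = one" and mult: "\<phi> (w \<cdot> w) = \<phi> w \<cdot> \<phi> w"
      using that[unfolded Aut_bullet] Aut_map_one[of \<phi>] by (auto simp: Aut_def bij_is_inj)
    have "\<phi> w \<notin> range (\<lambda>a. a *s one)"
    proof
      assume "\<phi> w \<in> range (\<lambda>a. a *s one)"
      then obtain a where "\<phi> w = \<phi> (a *s one)" by (auto simp: \<phi>.scale one)
      then show False using injD[OF \<open>inj \<phi>\<close>] assms by (auto simp: omega_elt_def)
    qed
    moreover have "\<phi> (w \<cdot> w + w + one) = 0" using assms by (simp add: omega_elt_iff \<phi>.zero)
    then have "\<phi> w \<cdot> \<phi> w + \<phi> w + one = 0" by (simp add: \<phi>.add mult one)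
    ultimately show ?thesis by (simp add: omega_elt_iff)
  qed
  then show ?thesis
    using omega_elts_conjugate[OF assms] unfolding conj_class_def Aut_bullet by blast
qed

end

lemma CHAR_eq_3_iff: "CHAR('f::field) = 3 \<longleftrightarrow> (3::'f) = 0"
proof
  assume "(3::'f) = 0"
  then have "CHAR('f) dvd 3" using of_nat_eq_0_iff_char_dvd[of 3, where ?'a='f] by simp
  moreover have "CHAR('f) = 0 \<or> CHAR('f) = 1 \<or> CHAR('f) = 2 \<or> CHAR('f) = 3"
    using dvd_imp_le[OF \<open>CHAR('f) dvd 3\<close>] by linarith
  ultimately show "CHAR('f) = 3" using CHAR_not_1[where ?'a='f] by auto
next
  assume "CHAR('f) = 3"
  then show "(3::'f) = 0" using of_nat_CHAR[where ?'a='f] by simp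
qed

theorem corollary4p4:
  fixes scale :: "'f::field \<Rightarrow> 'c::ab_group_add \<Rightarrow> 'c"
    and cmult :: "'c \<Rightarrow> 'c \<Rightarrow> 'c"
    and one :: 'c
    and n :: "'c \<Rightarrow> 'f"
    and bullet :: "'c \<Rightarrow> 'c \<Rightarrow> 'c"
  assumes cayley: "cayley_algebra scale cmult one n"
    and bullet: "bullet = para_mult scale cmult one n"
  shows "para_units scale bullet n = {one} \<and>
    idempotents bullet =
      {one} \<union> {w. w \<notin> range (\<lambda>a. scale a one) \<and> cmult w w + w + one = 0} \<and>
    Aut scale cmult n = Aut scale bullet n \<and>
    (\<forall>e \<in> idempotents bullet - {one}. \<forall>f \<in> idempotents bullet - {one}.
       \<exists>\<phi> \<in> Aut scale cmult n. \<phi> e = f) \<and>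
    (if (CHAR('f) \<noteq> 3 \<and> contains_copy_of_omega_alg scale cmult) \<or>
        (CHAR('f) = 3 \<and> isotropic_form n)
     then one \<in> idempotents bullet \<and>
       (\<exists>!K. K \<in> conj_class (Aut scale bullet n) ` (idempotents bullet - {one}))
     else idempotents bullet = {one})"
proof -
  interpret cayley_algebra scale cmult one n by fact
  have idem: "idempotents bullet - {one} = {w. omega_elt w}"
    using idempotents_bullet omega_elt_neq_one by (auto simp: bullet)
  \<comment> \<open>The case condition of the theorem is exactly the existence of an idempotent
    other than \<open>one\<close>.\<close>
  have nontrivial: "(\<exists>w. omega_elt w) \<longleftrightarrow>
      (CHAR('f) \<noteq> 3 \<and> contains_copy_of_omega_alg scale cmult) \<or>
      (CHAR('f) = 3 \<and> isotropic_form n)"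
    using exists_omega_elt_char_3 omega_elt_imp_copy copy_imp_omega_elt
    by (auto simp: CHAR_eq_3_iff)
  have class_eq: "conj_class (Aut scale bullet n) w = {w. omega_elt w}" if "omega_elt w" for w
    using conj_class_omega_elt[OF that] by (simp add: bullet)
  have idem': "idempotents bullet = {one} \<union> {w. omega_elt w}"
    using idempotents_bullet by (simp add: bullet)
  have cases: "if \<exists>w. omega_elt w
    then one \<in> idempotents bullet \<and>
      (\<exists>!K. K \<in> conj_class (Aut scale bullet n) ` (idempotents bullet - {one}))
    else idempotents bullet = {one}"
  proof (cases "\<exists>w. omega_elt w")
    case True
    then have "conj_class (Aut scale bullet n) ` (idempotents bullet - {one}) = {{w. omega_elt w}}"
      unfolding idem using class_eq by (auto simp: image_iff)
    then show ?thesis using True idem' by simp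
  next
    case False
    then show ?thesis using idem' by simp
  qed
  have roots: "{w. omega_elt w} = {w. w \<notin> range (\<lambda>a. scale a one) \<and> cmult w w + w + one = 0}"
    using omega_elt_iff by blast
  show ?thesis
  proof (intro conjI)
    show "para_units scale bullet n = {one}" using para_units_bullet by (simp add: bullet)
    show "idempotents bullet =
      {one} \<union> {w. w \<notin> range (\<lambda>a. scale a one) \<and> cmult w w + w + one = 0}"
      using idem' roots by simp
    show "Aut scale cmult n = Aut scale bullet n" using Aut_bullet by (simp add: bullet)
    show "\<forall>e \<in> idempotents bullet - {one}. \<forall>f \<in> idempotents bullet - {one}.
       \<exists>\<phi> \<in> Aut scale cmult n. \<phi> e = f"
      unfolding idem using omega_elts_conjugate by blast
  qed (use cases[unfolded nontrivial] in assumption)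
qed

end
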